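(* For any prime $p$ there exists $\lambda>0$, depending only on $p$, such that for every group $G$ which is either a Heisenberg group $H_{n-1}(\mathbb{F}_p)$ with $n\geq 1$, or a group $UT(n,\mathbb{F}_p)$ of upper unitriangular $n\times n$ matrices over $\mathbb{F}_p$ with $n\geq 2$, there exists a linear subspace $X\subset\mathbb{F}_p[G]$ such that $X^3=0$ and $\operatorname{codim}X<|G|^{1-\lambda}$.
   Context: The Heisenberg group $H_{n-1}(\mathbb{F}_p)$, of order $p^{2n-1}$, is the group of $(n+1)\times(n+1)$ matrices $(a_{ij})_{0\leq i,j\leq n}$ over $\mathbb{F}_p$ such that $a_{ii}=1$ for all $i$, and $a_{ij}=0$ unless $i=j$ or ($i=0$ and $j>0$) or ($j=n$ and $i<n$). The group $UT(n,\mathbb{F}_p)$, of order $p^{n(n-1)/2}$, is the group of upper triangular $n\times n$ matrices over $\mathbb{F}_p$ with all diagonal entries equal to $1$. $\mathbb{F}_p[G]$ is the group algebra, $X^3=0$ means $u_1u_2u_3=0$ for all $u_1,u_2,u_3\in X$, and $\operatorname{codim}X=|G|-\dim_{\mathbb{F}_p}X$. *)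

theory Defs
  imports
    "HOL-Algebra.Group"
    "HOL-Algebra.Coset"
    "HOL-Library.Function_Algebras"
    "Jordan_Normal_Form.Matrix"
    "Berlekamp_Zassenhaus.Finite_Field"
begin

text \<open>The field with \<open>p\<close> elements is the type \<open>'p mod_ring\<close> with \<open>'p :: prime_card\<close> and \<open>p = CARD('p)\<close>.\<close>

text \<open>
  \<open>heisenberg_group m\<close> is $H_m$: square matrices of size \<open>n + 1\<close>, indexed from \<open>0\<close> to \<open>n\<close>,
  where \<open>n = m + 1\<close>.  It has order \<open>q ^ (2 * m + 1)\<close> over a field with \<open>q\<close> elements.
\<close>

definition heisenberg_group :: "nat \<Rightarrow> 'a::field mat monoid" where
  "heisenberg_group m = (let n = m + 1 in
     \<lparr>carrier = {A \<in> carrier_mat (n + 1) (n + 1).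
        (\<forall>i\<le>n. A $$ (i, i) = 1) \<and>
        (\<forall>i\<le>n. \<forall>j\<le>n. \<not> (i = j \<or> (i = 0 \<and> j > 0) \<or> (j = n \<and> i < n)) \<longrightarrow> A $$ (i, j) = 0)},
      monoid.mult = (*), one = 1\<^sub>m (n + 1)\<rparr>)"

definition unitriangular_group :: "nat \<Rightarrow> 'a::field mat monoid" where
  "unitriangular_group n =
     \<lparr>carrier = {A \<in> carrier_mat n n. upper_triangular A \<and> (\<forall>i<n. A $$ (i, i) = 1)},
      monoid.mult = (*), one = 1\<^sub>m n\<rparr>"

text \<open>
  The group algebra of a finite group \<open>G\<close>: the function \<open>u\<close> stands for the formal sum of the
  \<open>u g\<close> multiples of \<open>g\<close> in \<open>carrier G\<close>, and vanishes outside \<open>carrier G\<close>.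
  The multiplication is convolution; pointwise multiplication of functions plays no role.
\<close>

definition group_algebra :: "('g, 'm) monoid_scheme \<Rightarrow> ('g \<Rightarrow> 'a::field) set" where
  "group_algebra G = {u. \<forall>g. g \<notin> carrier G \<longrightarrow> u g = 0}"

definition ga_mult ::
  "('g, 'm) monoid_scheme \<Rightarrow> ('g \<Rightarrow> 'a::field) \<Rightarrow> ('g \<Rightarrow> 'a) \<Rightarrow> ('g \<Rightarrow> 'a)" where
  "ga_mult G u v =
     (\<lambda>g. \<Sum>(h, k) \<in> {(h, k). h \<in> carrier G \<and> k \<in> carrier G \<and> h \<otimes>\<^bsub>G\<^esub> k = g}. u h * v k)"

definition fun_scale :: "'a::field \<Rightarrow> ('g \<Rightarrow> 'a) \<Rightarrow> ('g \<Rightarrow> 'a)" where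
  "fun_scale c u = (\<lambda>g. c * u g)"

interpretation fun_space: vector_space "fun_scale :: 'a::field \<Rightarrow> ('g \<Rightarrow> 'a) \<Rightarrow> ('g \<Rightarrow> 'a)"
  by unfold_locales (auto simp: fun_scale_def fun_eq_iff algebra_simps)

text \<open>A real number, so that the subtraction is not truncated.\<close>

definition ga_codim :: "('g, 'm) monoid_scheme \<Rightarrow> ('g \<Rightarrow> 'a::field) set \<Rightarrow> real" where
  "ga_codim G X = real (Coset.order G) - real (fun_space.dim X)"

definition cube_zero :: "('g, 'm) monoid_scheme \<Rightarrow> ('g \<Rightarrow> 'a::field) set \<Rightarrow> bool" where
  "cube_zero G X \<longleftrightarrow> (\<forall>u\<^sub>1\<in>X. \<forall>u\<^sub>2\<in>X. \<forall>u\<^sub>3\<in>X. ga_mult G (ga_mult G u\<^sub>1 u\<^sub>2) u\<^sub>3 = 0)"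

end

theory Submission
  imports Defs
begin

text \<open>
  Both families consist of the matrices \<open>A\<close> with \<open>A\<^sub>i\<^sub>i = 1\<close> whose other nonzero entries satisfy
  \<open>l i < l j\<close>, for a level function \<open>l\<close> on the indices: the identity for the unitriangular group, and
  levels \<open>0, 1, \<dots>, 1, 2\<close> for the Heisenberg group.  Give the free entry \<open>(i, j)\<close> the weight \<open>l j - l i\<close>.
  Then the entries of \<open>A * B * C\<close> are weighted homogeneous in the entries of \<open>A\<close>, \<open>B\<close> and \<open>C\<close>.
  By Fermat's theorem the indicator function of \<open>A * B * C = g\<close> is a polynomial of weighted degree at most
  \<open>L\<close>, where \<open>L\<close> is \<open>p - 1\<close> times the sum of all weights.  Each of its monomials has degree at most
  \<open>L / 3\<close> in one of \<open>A\<close>, \<open>B\<close>, \<open>C\<close>.  So \<open>X\<^sup>3 = 0\<close> for the space \<open>X\<close> of all \<open>u\<close> that are orthogonal to the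
  monomials of degree at most \<open>L / 3\<close>.  The codimension of \<open>X\<close> is at most the number of such
  reduced monomials, which a Chernoff bound shows to be exponentially small compared with \<open>|G|\<close>, since the
  average weight is at least a third of the maximal weight.
\<close>

subsection \<open>Counting exponent vectors of low weighted degree\<close>

text \<open>The tangent of \<open>exp\<close> at \<open>x * y\<close> lies below the graph at the
  points 0 and \<open>y\<close>. Combining these two inequalities with weights \<open>1 - x\<close>
  and \<open>x\<close> gives this case of convexity.\<close>

lemma exp_mult_le_chord:
  fixes x y :: real
  assumes "0 \<le> x" "x \<le> 1"
  shows "exp (x * y) \<le> 1 - x + x * exp y"
proof -
  have "exp (x * y) * (1 - x * y) \<le> exp (x * y) * exp (- (x * y))"
    using exp_ge_add_one_self[of "- (x * y)"] by (intro mult_left_mono) auto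
  then have 1: "exp (x * y) * (1 - x * y) \<le> 1"
    by (simp flip: exp_add)
  have "exp (x * y) * (1 + (y - x * y)) \<le> exp (x * y) * exp (y - x * y)"
    using exp_ge_add_one_self[of "y - x * y"] by (intro mult_left_mono) auto
  then have 2: "exp (x * y) * (1 + (y - x * y)) \<le> exp y"
    by (simp flip: exp_add)
  have "exp (x * y) = (1 - x) * (exp (x * y) * (1 - x * y)) + x * (exp (x * y) * (1 + (y - x * y)))"
    by (simp add: algebra_simps)
  also have "\<dots> \<le> (1 - x) * 1 + x * exp y"
    using assms 1 2 by (intro add_mono mult_left_mono) auto
  finally show ?thesis by simp
qed

text \<open>At 0 the sum equals \<open>p\<close> and has derivative
  \<open>- p * (p - 1) / 2\<close>, so it drops below \<open>p\<close> for small positive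
  \<open>t\<close>. The sign is negative because the mean \<open>(p - 1) / 2\<close> of a uniform
  exponent exceeds the threshold \<open>(p - 1) / 3\<close>.\<close>

lemma exists_exp_sum_less:
  assumes "p \<ge> 2"
  shows "\<exists>t::real. t > 0 \<and> (\<Sum>e<p. exp (t * (real (p - 1) - 3 * real e))) < real p"
proof -
  let ?f = "\<lambda>t::real. \<Sum>e<p. exp (t * (real (p - 1) - 3 * real e))"
  let ?l = "\<Sum>e<p. real (p - 1) - 3 * real e"
  have "(?f has_real_derivative ?l) (at 0)"
    by (auto intro!: derivative_eq_intros)
  moreover have "?l < 0"
  proof -
    have gauss: "2 * (\<Sum>e<k. real e) = real k * (real k - 1)" for k
      by (induction k) (auto simp: algebra_simps)
    have p: "real (p - 1) = real p - 1"
      using assms by (simp add: of_nat_diff)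
    have "2 * ?l = 2 * (real p * (real p - 1)) - 3 * (2 * (\<Sum>e<p. real e))"
      by (simp add: p sum_subtractf sum_distrib_left)
    also have "\<dots> = - (real p * (real p - 1))"
      unfolding gauss by (simp add: algebra_simps)
    also have "\<dots> < 0"
      using assms by simp
    finally show ?thesis by simp
  qed
  ultimately obtain d where d: "d > 0" "\<And>h. 0 < h \<Longrightarrow> h < d \<Longrightarrow> ?f (0 + h) < ?f 0"
    using DERIV_neg_dec_right by blast
  have "?f (d / 2) < ?f 0"
    using d(2)[of "d / 2"] d(1) by simp
  then show ?thesis
    using \<open>d > 0\<close> by (intro exI[of _ "d / 2"]) auto
qed

text \<open>
  A Chernoff bound: if the exponents were chosen uniformly at random, the weighted degree would have
  mean \<open>(p - 1) * (\<Sum>s\<in>S. w s) / 2\<close>.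
\<close>

lemma card_low_degree_exponents_le:
  fixes w :: "'s \<Rightarrow> nat" and t :: real
  assumes "finite S" "W > 0" and w_le: "\<And>s. s \<in> S \<Longrightarrow> w s \<le> W"
    and avg: "card S * W \<le> 3 * (\<Sum>s\<in>S. w s)"
    and t: "(\<Sum>e<p. exp (t * (real (p - 1) - 3 * real e))) = real p * (1 - \<delta>)" and "t > 0" "\<delta> > 0"
  shows "real (card {e \<in> PiE S (\<lambda>_. {..<p}). 3 * (\<Sum>s\<in>S. w s * e s) \<le> (p - 1) * (\<Sum>s\<in>S. w s)})
    \<le> real p ^ card S * exp (- (\<delta> / 3 * card S))" (is "real (card ?B) \<le> _")
proof -
  \<comment> \<open>Scaling the weights into [0, 1] makes the chord bound applicable, so one
    \<open>t\<close> serves all weights.\<close>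
  define x where "x s = real (w s) / real W" for s
  define z where "z e = t * (real (p - 1) - 3 * real e)" for e
  have x01: "0 \<le> x s" "x s \<le> 1" if "s \<in> S" for s
    using w_le[OF that] \<open>W > 0\<close> by (auto simp: x_def)
  have fin: "finite (PiE S (\<lambda>_. {..<p}))"
    using \<open>finite S\<close> by (intro finite_PiE) auto
  have "real (card ?B) = (\<Sum>e\<in>?B. 1)"
    by simp
  \<comment> \<open>On \<open>?B\<close> the exponent is \<open>t / W\<close> times a nonnegative
    number, so each term is at least 1.\<close>
  also have "\<dots> \<le> (\<Sum>e\<in>?B. exp (\<Sum>s\<in>S. x s * z (e s)))"
  proof (rule sum_mono)
    fix e assume "e \<in> ?B"
    then have "3 * (\<Sum>s\<in>S. w s * e s) \<le> (p - 1) * (\<Sum>s\<in>S. w s)"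
      by simp
    then have "real (3 * (\<Sum>s\<in>S. w s * e s)) \<le> real ((p - 1) * (\<Sum>s\<in>S. w s))"
      by (simp only: of_nat_le_iff)
    moreover have "(\<Sum>s\<in>S. x s * z (e s))
        = t / real W * (real ((p - 1) * (\<Sum>s\<in>S. w s)) - real (3 * (\<Sum>s\<in>S. w s * e s)))"
    proof -
      have "x s * z (e s) = t / real W * (real (p - 1) * real (w s) - 3 * (real (w s) * real (e s)))" for s
        by (simp add: x_def z_def algebra_simps)
      then show ?thesis
        by (simp only: of_nat_mult of_nat_sum of_nat_numeral sum_distrib_left flip: sum_subtractf)
    qed
    ultimately show "1 \<le> exp (\<Sum>s\<in>S. x s * z (e s))"
      using \<open>t > 0\<close> by simp
  qed
  also have "\<dots> \<le> (\<Sum>e\<in>PiE S (\<lambda>_. {..<p}). exp (\<Sum>s\<in>S. x s * z (e s)))"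
    using fin by (intro sum_mono2) auto
  also have "\<dots> = (\<Sum>e\<in>PiE S (\<lambda>_. {..<p}). \<Prod>s\<in>S. exp (x s * z (e s)))"
    using \<open>finite S\<close> by (simp add: exp_sum)
  also have "\<dots> = (\<Prod>s\<in>S. \<Sum>e<p. exp (x s * z e))"
    using \<open>finite S\<close> by (intro prod_sum_PiE[symmetric]) auto
  \<comment> \<open>The chord bound reduces each factor to the sum known from \<open>t\<close>,
    giving at most \<open>p * (1 - \<delta> * x s)\<close>.\<close>
  also have "\<dots> \<le> (\<Prod>s\<in>S. real p * exp (- (\<delta> * x s)))"
  proof (rule prod_mono, rule conjI)
    fix s assume "s \<in> S"
    show "0 \<le> (\<Sum>e<p. exp (x s * z e))"
      by (intro sum_nonneg) simp
    have "(\<Sum>e<p. exp (x s * z e)) \<le> (\<Sum>e<p. 1 - x s + x s * exp (z e))"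
      using x01[OF \<open>s \<in> S\<close>] by (intro sum_mono exp_mult_le_chord)
    also have "\<dots> = real p * (1 - x s) + x s * (\<Sum>e<p. exp (z e))"
      by (simp add: sum.distrib sum_distrib_left)
    also have "\<dots> = real p * (1 + - (\<delta> * x s))"
      unfolding z_def t by (simp add: algebra_simps)
    also have "\<dots> \<le> real p * exp (- (\<delta> * x s))"
      using exp_ge_add_one_self[of "- (\<delta> * x s)"] by (intro mult_left_mono) auto
    finally show "(\<Sum>e<p. exp (x s * z e)) \<le> real p * exp (- (\<delta> * x s))" .
  qed
  also have "\<dots> = real p ^ card S * exp (- (\<delta> * (\<Sum>s\<in>S. x s)))"
    using \<open>finite S\<close> by (simp add: prod.distrib sum_distrib_left sum_negf flip: exp_sum)
  also have "\<dots> \<le> real p ^ card S * exp (- (\<delta> / 3 * card S))"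
  proof -
    \<comment> \<open>By \<open>avg\<close> the scaled weights sum to at least a third of
      \<open>card S\<close>, whence the exponent \<open>\<delta> / 3\<close>.\<close>
    have "real (card S) * real W \<le> 3 * (\<Sum>s\<in>S. real (w s))"
      using avg by (metis of_nat_le_iff of_nat_mult of_nat_numeral of_nat_sum)
    then have "real (card S) \<le> 3 * (\<Sum>s\<in>S. x s)"
      using \<open>W > 0\<close> by (simp add: x_def field_simps flip: sum_divide_distrib)
    then have "\<delta> * real (card S) \<le> \<delta> * (3 * (\<Sum>s\<in>S. x s))"
      using \<open>\<delta> > 0\<close> by (intro mult_left_mono) auto
    then show ?thesis
      by (intro mult_left_mono) auto
  qed
  finally show ?thesis .
qed

subsection \<open>Codimension of common kernels\<close>

text \<open>A basis of the kernel together with one vector outside the kernel spans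
  \<open>V\<close>. The finite set \<open>W\<close> bounds the size of that basis, so that
  \<open>card\<close> is meaningful.\<close>

lemma dim_le_dim_kernel_plus_1:
  fixes V :: "('g \<Rightarrow> 'a::field) set"
  assumes "fun_space.subspace V" "V \<subseteq> fun_space.span W" "finite W"
    and add: "\<And>u v. \<phi> (u + v) = \<phi> u + \<phi> v" and scale: "\<And>c u. \<phi> (fun_scale c u) = c * \<phi> u"
  shows "fun_space.dim V \<le> fun_space.dim {v \<in> V. \<phi> v = (0::'a)} + 1"
proof -
  let ?K = "{v \<in> V. \<phi> v = 0}"
  obtain B where B: "B \<subseteq> ?K" "fun_space.independent B" "?K \<subseteq> fun_space.span B"
      "card B = fun_space.dim ?K"
    by (rule fun_space.basis_exists)
  have finB: "finite B"
    using fun_space.independent_span_bound[OF \<open>finite W\<close> B(2)] B(1) assms(2) by blast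
  obtain v where v: "V \<subseteq> fun_space.span (insert v B)"
  proof (cases "\<exists>v\<in>V. \<phi> v \<noteq> 0")
    case True
    then obtain v where v: "v \<in> V" "\<phi> v \<noteq> 0" by blast
    have "u \<in> fun_space.span (insert v B)" if "u \<in> V" for u
    proof -
      define c where "c = - \<phi> u / \<phi> v"
      have "u + fun_scale c v \<in> V"
        using assms(1) that v(1) by (intro fun_space.subspace_add fun_space.subspace_scale)
      moreover have "\<phi> (u + fun_scale c v) = 0"
        unfolding add scale c_def using v(2) by simp
      ultimately have 1: "u + fun_scale c v \<in> fun_space.span (insert v B)"
        using B(3) fun_space.span_mono[of B "insert v B"] by blast
      have "u = (u + fun_scale c v) + fun_scale (- c) v"
        by (simp add: fun_eq_iff fun_scale_def)
      also have "\<dots> \<in> fun_space.span (insert v B)"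
        by (intro fun_space.span_add fun_space.span_scale 1 fun_space.span_base) simp
      finally show ?thesis .
    qed
    then show ?thesis using that by blast
  next
    case False
    \<comment> \<open>The kernel is all of \<open>V\<close>; inserting 0 only gives the spanning set
      the required shape.\<close>
    then show ?thesis
      using that B(3) fun_space.span_mono[of B "insert 0 B"] by blast
  qed
  have "fun_space.dim V \<le> card (insert v B)"
    using fun_space.dim_le_card[OF v] finB by simp
  also have "\<dots> \<le> fun_space.dim ?K + 1"
    using finB B(4) by (simp add: card_insert_if)
  finally show ?thesis .
qed

text \<open>Each functional costs at most one dimension. The subspace claim is carried through the
  induction because the next functional is applied on the kernel reached so far.\<close>

lemma dim_le_dim_common_kernel:
  fixes V :: "('g \<Rightarrow> 'a::field) set"
  assumes "finite I" "fun_space.subspace V" "V \<subseteq> fun_space.span W" "finite W"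
    and add: "\<And>i u v. \<phi> i (u + v) = \<phi> i u + \<phi> i v"
    and scale: "\<And>i c u. \<phi> i (fun_scale c u) = c * \<phi> i u"
  shows "fun_space.subspace {v \<in> V. \<forall>i\<in>I. \<phi> i v = (0::'a)} \<and>
    fun_space.dim V \<le> fun_space.dim {v \<in> V. \<forall>i\<in>I. \<phi> i v = 0} + card I"
  using assms(1)
proof induction
  case empty
  then show ?case using assms(2) by simp
next
  case (insert i I)
  let ?K = "{v \<in> V. \<forall>i\<in>I. \<phi> i v = 0}"
  have eq: "{v \<in> V. \<forall>i\<in>insert i I. \<phi> i v = 0} = {v \<in> ?K. \<phi> i v = 0}"
    by auto
  have sub: "fun_space.subspace ?K"
    using insert.IH by simp
  have zero: "\<phi> i 0 = 0"
    using scale[of i 0 0] by (simp add: fun_scale_def zero_fun_def)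
  have "fun_space.subspace {v \<in> ?K. \<phi> i v = 0}"
    unfolding fun_space.subspace_def
    using fun_space.subspace_0[OF sub] fun_space.subspace_add[OF sub] fun_space.subspace_scale[OF sub] zero
    by (auto simp: add scale)
  moreover have "fun_space.dim ?K \<le> fun_space.dim {v \<in> ?K. \<phi> i v = 0} + 1"
    using sub assms(3,4) add scale by (intro dim_le_dim_kernel_plus_1) auto
  ultimately show ?case
    unfolding eq using insert by auto
qed

lemma group_algebra_basis:
  assumes "finite (carrier G)"
  defines "\<Delta> \<equiv> (\<lambda>g h. if h = g then 1 else 0 :: 'a::field) ` carrier G"
  shows "fun_space.subspace (group_algebra G :: (_ \<Rightarrow> 'a) set)" "finite \<Delta>" "group_algebra G = fun_space.span \<Delta>"
    "fun_space.dim (group_algebra G :: (_ \<Rightarrow> 'a) set) = card (carrier G)"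
proof -
  let ?d = "\<lambda>g h. if h = g then 1 else 0 :: 'a"
  show sub: "fun_space.subspace (group_algebra G :: (_ \<Rightarrow> 'a) set)"
    by (auto simp: fun_space.subspace_def group_algebra_def fun_scale_def)
  show fin: "finite \<Delta>"
    using assms by simp
  have inj: "inj_on ?d (carrier G)"
    by (rule inj_onI) (metis zero_neq_one)
  have sum_eq: "(\<Sum>g\<in>carrier G. fun_scale (c g) (?d g)) h = (if h \<in> carrier G then c h else 0)" for c h
  proof -
    have "(\<Sum>g\<in>A. fun_scale (c g) (?d g)) h = (\<Sum>g\<in>A. c g * ?d g h)" if "finite A" for A
      using that by induction (auto simp: fun_scale_def)
    then show ?thesis
      using assms(1) by (simp add: if_distrib cong: if_cong)
  qed
  show span: "group_algebra G = fun_space.span \<Delta>"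
  proof
    show "fun_space.span \<Delta> \<subseteq> group_algebra G"
      using sub by (intro fun_space.span_minimal) (auto simp: \<Delta>_def group_algebra_def)
    show "group_algebra G \<subseteq> fun_space.span \<Delta>"
    proof
      fix u :: "_ \<Rightarrow> 'a" assume "u \<in> group_algebra G"
      then have "u = (\<Sum>g\<in>carrier G. fun_scale (u g) (?d g))"
        by (auto simp: fun_eq_iff sum_eq group_algebra_def)
      also have "\<dots> \<in> fun_space.span \<Delta>"
        by (intro fun_space.span_sum fun_space.span_scale fun_space.span_base) (auto simp: \<Delta>_def)
      finally show "u \<in> fun_space.span \<Delta>" .
    qed
  qed
  have "fun_space.independent \<Delta>"
  proof (rule fun_space.independent_if_scalars_zero[OF fin])
    fix f v assume 0: "(\<Sum>v\<in>\<Delta>. fun_scale (f v) v) = 0" and "v \<in> \<Delta>"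
    then obtain g where g: "g \<in> carrier G" "v = ?d g"
      by (auto simp: \<Delta>_def)
    have "(\<Sum>g\<in>carrier G. fun_scale (f (?d g)) (?d g)) = 0"
      using 0 inj by (simp add: \<Delta>_def sum.reindex)
    then have "(\<Sum>g\<in>carrier G. fun_scale (f (?d g)) (?d g)) g = 0"
      by simp
    then show "f v = 0"
      using g unfolding sum_eq by simp
  qed
  then show "fun_space.dim (group_algebra G :: (_ \<Rightarrow> 'a) set) = card (carrier G)"
    using inj by (simp add: span fun_space.dim_span_eq_card_independent \<Delta>_def card_image
        del: fun_space.dim_span)
qed

subsection \<open>Polynomial functions graded by weight\<close>

text \<open>Multiplication by \<open>x\<close> permutes the nonzero elements, so their product
  equals itself times this power of \<open>x\<close>.\<close>

lemma finite_field_power_card: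
  fixes x :: "'a::{field,finite}"
  assumes "x \<noteq> 0"
  shows "x ^ (CARD('a) - 1) = 1"
proof -
  let ?P = "\<Prod>y\<in>UNIV - {0::'a}. y"
  have "bij_betw (\<lambda>y. x * y) (UNIV - {0}) (UNIV - {0})"
    using assms by (intro bij_betwI[where g = "\<lambda>y. y / x"]) auto
  then have "?P = (\<Prod>y\<in>UNIV - {0}. x * y)"
    by (rule prod.reindex_bij_betw[symmetric])
  also have "\<dots> = x ^ (CARD('a) - 1) * ?P"
    by (simp add: prod.distrib card_Diff_subset)
  finally show ?thesis by simp
qed

text \<open>Subtracting \<open>CARD('a) - 1\<close> from an exponent that is at least
  \<open>CARD('a)\<close> does not change the power function; at 0 this is right because the new
  exponent is still positive.\<close>

lemma finite_field_power_reduce: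
  obtains e' where "e' < CARD('a)" "e' \<le> e" "\<And>x::'a::{field,finite}. x ^ e' = x ^ e"
proof (induction e arbitrary: thesis rule: less_induct)
  case (less e)
  let ?q = "CARD('a)"
  have q: "?q > 1"
    using card_mono[of "UNIV :: 'a set" "{0, 1}"] by simp
  show ?case
  proof (cases "e < ?q")
    case True
    then show ?thesis using less.prems by blast
  next
    case False
    then have lt: "e - (?q - 1) < e"
      using q by linarith
    obtain e' where e': "e' < ?q" "e' \<le> e - (?q - 1)"
        "\<And>x::'a. x ^ e' = x ^ (e - (?q - 1))"
      using less.IH[OF lt] by blast
    have "x ^ (e - (?q - 1)) = x ^ e" for x :: 'a
    proof (cases "x = 0")
      case True
      then show ?thesis using False q by (simp add: power_0_left)
    next
      case nz: False
      have "x ^ e = x ^ (e - (?q - 1)) * x ^ (?q - 1)"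
        using False by (simp flip: power_add)
      then show ?thesis using finite_field_power_card[OF nz] by simp
    qed
    then show ?thesis using less.prems[of e'] e' by simp
  qed
qed

definition monomial_fun :: "'v set \<Rightarrow> ('v \<Rightarrow> nat) \<Rightarrow> ('v \<Rightarrow> 'a::field) \<Rightarrow> 'a" where
  "monomial_fun V e x = (\<Prod>v\<in>V. x v ^ e v)"

text \<open>These are functions, not formal polynomials: membership means that some representation
  has weighted degree at most \<open>D\<close>.\<close>

definition weighted_polys :: "'v set \<Rightarrow> ('v \<Rightarrow> nat) \<Rightarrow> nat \<Rightarrow> (('v \<Rightarrow> 'a::field) \<Rightarrow> 'a) set" where
  "weighted_polys V w D = fun_space.span {monomial_fun V e | e. (\<Sum>v\<in>V. w v * e v) \<le> D}"

lemma subspace_weighted_polys: "fun_space.subspace (weighted_polys V w D)"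
  unfolding weighted_polys_def by (rule fun_space.subspace_span)

lemma weighted_polys_scale: "f \<in> weighted_polys V w D \<Longrightarrow> (\<lambda>x. c * f x) \<in> weighted_polys V w D"
  using fun_space.subspace_scale[OF subspace_weighted_polys] by (simp add: fun_scale_def)

lemma weighted_polys_const: "(\<lambda>x. c) \<in> weighted_polys V w D"
proof -
  have "monomial_fun V (\<lambda>_. 0) \<in> weighted_polys V w D"
    unfolding weighted_polys_def by (intro fun_space.span_base) auto
  from weighted_polys_scale[OF this, of c] show ?thesis
    by (simp add: monomial_fun_def)
qed

lemma weighted_polys_var:
  assumes "finite V" "v \<in> V"
  shows "(\<lambda>x :: 'v \<Rightarrow> 'a::field. x v) \<in> weighted_polys V w (w v)"
proof -
  let ?e = "\<lambda>u. if u = v then 1 else 0::nat"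
  have "(\<Prod>u\<in>V. x u ^ ?e u) = x v" for x :: "'v \<Rightarrow> 'a"
  proof -
    have "(\<Prod>u\<in>V. x u ^ ?e u) = (\<Prod>u\<in>V. if u = v then x u else 1)"
      by (intro prod.cong) auto
    then show ?thesis using assms by simp
  qed
  then have "(\<lambda>x :: 'v \<Rightarrow> 'a. x v) = monomial_fun V ?e"
    by (simp add: fun_eq_iff monomial_fun_def)
  moreover have "(\<Sum>u\<in>V. w u * ?e u) \<le> w v"
    using assms by (simp add: if_distrib cong: if_cong)
  ultimately show ?thesis
    unfolding weighted_polys_def by (intro fun_space.span_base) blast
qed

lemma weighted_polys_add:
  "f \<in> weighted_polys V w D \<Longrightarrow> g \<in> weighted_polys V w D \<Longrightarrow> (\<lambda>x. f x + g x) \<in> weighted_polys V w D"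
  using fun_space.subspace_add[OF subspace_weighted_polys] by (simp add: plus_fun_def)

lemma weighted_polys_diff:
  "f \<in> weighted_polys V w D \<Longrightarrow> g \<in> weighted_polys V w D \<Longrightarrow> (\<lambda>x. f x - g x) \<in> weighted_polys V w D"
  using fun_space.subspace_diff[OF subspace_weighted_polys] by (simp add: fun_diff_def)

lemma weighted_polys_sum:
  assumes "\<And>i. i \<in> I \<Longrightarrow> f i \<in> weighted_polys V w D"
  shows "(\<lambda>x. \<Sum>i\<in>I. f i x) \<in> weighted_polys V w D"
  using assms
  by (induction I rule: infinite_finite_induct)
    (auto intro!: weighted_polys_add weighted_polys_const)

text \<open>The product is bilinear and exponents of monomials add. The passage from monomials to
  spans is made for one factor at a time.\<close>

lemma weighted_polys_mult:
  assumes f: "f \<in> weighted_polys V w D" and g: "g \<in> weighted_polys V w E"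
  shows "(\<lambda>x. f x * g x) \<in> weighted_polys V w (D + E)"
proof -
  let ?W = "weighted_polys V w (D + E)"
  have sub: "fun_space.subspace {f. (\<lambda>x. f x * g x) \<in> ?W}" for g
    using weighted_polys_add[of _ V w "D + E"] weighted_polys_scale[of _ V w "D + E"]
    by (auto simp: fun_space.subspace_def fun_scale_def weighted_polys_const distrib_right mult.assoc)
  have 1: "(\<lambda>x. monomial_fun V e x * monomial_fun V e' x) \<in> ?W"
    if "(\<Sum>v\<in>V. w v * e v) \<le> D" "(\<Sum>v\<in>V. w v * e' v) \<le> E" for e e'
  proof -
    have "(\<lambda>x. monomial_fun V e x * monomial_fun V e' x) = monomial_fun V (\<lambda>v. e v + e' v)"
      by (simp add: monomial_fun_def fun_eq_iff power_add prod.distrib)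
    moreover have "(\<Sum>v\<in>V. w v * (e v + e' v)) \<le> D + E"
      using that by (simp add: distrib_left sum.distrib)
    ultimately show ?thesis
      unfolding weighted_polys_def by (intro fun_space.span_base) blast
  qed
  have 2: "(\<lambda>x. f x * monomial_fun V e' x) \<in> ?W" if "(\<Sum>v\<in>V. w v * e' v) \<le> E" for e'
  proof -
    have "weighted_polys V w D \<subseteq> {f. (\<lambda>x. f x * monomial_fun V e' x) \<in> ?W}"
      unfolding weighted_polys_def[of V w D]
      using 1 that by (intro fun_space.span_minimal sub) auto
    then show ?thesis using f by blast
  qed
  have "weighted_polys V w E \<subseteq> {g. (\<lambda>x. g x * f x) \<in> ?W}"
    unfolding weighted_polys_def[of V w E]
    using 2 by (intro fun_space.span_minimal sub) (auto simp: mult.commute)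
  then show ?thesis using g by (auto simp: mult.commute)
qed

lemma weighted_polys_prod:
  assumes "\<And>i. i \<in> I \<Longrightarrow> f i \<in> weighted_polys V w (D i)"
  shows "(\<lambda>x. \<Prod>i\<in>I. f i x) \<in> weighted_polys V w (\<Sum>i\<in>I. D i)"
  using assms
  by (induction I rule: infinite_finite_induct)
    (auto intro!: weighted_polys_mult weighted_polys_const)

lemma weighted_polys_power:
  "f \<in> weighted_polys V w D \<Longrightarrow> (\<lambda>x. f x ^ n) \<in> weighted_polys V w (n * D)"
  using weighted_polys_prod[of "{..<n}" "\<lambda>_. f" V w "\<lambda>_. D"] by simp

subsection \<open>Matrix groups given by levels\<close>

definition level_matrices :: "nat \<Rightarrow> (nat \<Rightarrow> nat) \<Rightarrow> 'a::field mat set" where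
  "level_matrices N l = {A \<in> carrier_mat N N.
     \<forall>i<N. \<forall>j<N. \<not> l i < l j \<longrightarrow> A $$ (i, j) = (if i = j then 1 else 0)}"

definition free_entries :: "nat \<Rightarrow> (nat \<Rightarrow> nat) \<Rightarrow> (nat \<times> nat) set" where
  "free_entries N l = {(i, j). i < N \<and> j < N \<and> l i < l j}"

definition entry_weight :: "(nat \<Rightarrow> nat) \<Rightarrow> nat \<times> nat \<Rightarrow> nat" where
  "entry_weight l = (\<lambda>(i, j). l j - l i)"

lemma finite_free_entries: "finite (free_entries N l)"
  by (rule finite_subset[of _ "{..<N} \<times> {..<N}"]) (auto simp: free_entries_def)

text \<open>Values of \<open>f\<close> off the free entries are ignored, so every \<open>f\<close>
  yields a matrix of the group and the entries can serve as unrestricted variables.\<close>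

definition matrix_of_entries :: "nat \<Rightarrow> (nat \<Rightarrow> nat) \<Rightarrow> (nat \<times> nat \<Rightarrow> 'a::field) \<Rightarrow> 'a mat" where
  "matrix_of_entries N l f = mat N N (\<lambda>(i, j). if l i < l j then f (i, j) else if i = j then 1 else 0)"

lemma matrix_of_entries_in: "matrix_of_entries N l f \<in> level_matrices N l"
  by (auto simp: matrix_of_entries_def level_matrices_def)

lemma matrix_of_entries_index:
  assumes "A \<in> level_matrices N l" "\<And>s. s \<in> free_entries N l \<Longrightarrow> f s = A $$ s"
  shows "matrix_of_entries N l f = A"
  using assms by (intro eq_matI) (auto simp: matrix_of_entries_def level_matrices_def free_entries_def)

lemma bij_betw_level_matrices:
  "bij_betw (\<lambda>A. restrict (\<lambda>s. A $$ s) (free_entries N l)) (level_matrices N l)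
     (PiE (free_entries N l) (\<lambda>_. UNIV))"
proof (rule bij_betwI[where g = "matrix_of_entries N l"])
  show "(\<lambda>A. restrict (\<lambda>s. A $$ s) (free_entries N l)) \<in> level_matrices N l \<rightarrow> free_entries N l \<rightarrow>\<^sub>E UNIV"
    by auto
  show "matrix_of_entries N l \<in> (free_entries N l \<rightarrow>\<^sub>E UNIV) \<rightarrow> level_matrices N l"
    by (auto simp: matrix_of_entries_in)
  show "matrix_of_entries N l (restrict (\<lambda>s. A $$ s) (free_entries N l)) = A" if "A \<in> level_matrices N l" for A
    using that by (intro matrix_of_entries_index) auto
  show "restrict (\<lambda>s. matrix_of_entries N l f $$ s) (free_entries N l) = f"
    if f: "f \<in> free_entries N l \<rightarrow>\<^sub>E UNIV" for f
  proof
    fix s show "restrict (\<lambda>s. matrix_of_entries N l f $$ s) (free_entries N l) s = f s"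
      using PiE_arb[OF f, of s]
      by (cases "s \<in> free_entries N l") (auto simp: matrix_of_entries_def free_entries_def)
  qed
qed

lemma level_matrices_finite_card:
  "finite (level_matrices N l :: 'a::{field,finite} mat set)"
  "card (level_matrices N l :: 'a mat set) = CARD('a) ^ card (free_entries N l)"
proof -
  have "finite (PiE (free_entries N l) (\<lambda>_. UNIV :: 'a set))"
    by (intro finite_PiE finite_free_entries) simp
  then show "finite (level_matrices N l :: 'a mat set)"
    using bij_betw_finite[OF bij_betw_level_matrices] by blast
  show "card (level_matrices N l :: 'a mat set) = CARD('a) ^ card (free_entries N l)"
    using bij_betw_same_card[OF bij_betw_level_matrices[of N l, where ?'a = 'a]]
    by (simp add: card_PiE finite_free_entries)
qed

lemma level_matrices_mult_index:
  assumes "A \<in> level_matrices N l" "B \<in> level_matrices N l" "i < N" "j < N"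
  shows "(A * B) $$ (i, j) = (\<Sum>k<N. A $$ (i, k) * B $$ (k, j))"
  using assms by (auto simp: level_matrices_def scalar_prod_def atLeast0LessThan intro!: sum.cong)

lemma level_matrices_mult_closed:
  fixes A B :: "'a::field mat"
  assumes A: "A \<in> level_matrices N l" and B: "B \<in> level_matrices N l"
  shows "A * B \<in> level_matrices N l"
proof -
  have "(A * B) $$ (i, j) = (if i = j then 1 else 0)" if ij: "i < N" "j < N" "\<not> l i < l j" for i j
  proof -
    \<comment> \<open>Only \<open>k = i\<close> can contribute: if \<open>l i < l k\<close>, then
      \<open>l j < l k\<close> and the entry of \<open>B\<close> is 0; otherwise
      \<open>A $$ (i, k)\<close> is an entry of the identity matrix.\<close>
    have "(A * B) $$ (i, j) = (\<Sum>k<N. if k = i then if i = j then 1 else 0 else 0)"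
      unfolding level_matrices_mult_index[OF A B ij(1,2)]
    proof (rule sum.cong[OF refl])
      fix k assume "k \<in> {..<N}"
      then show "A $$ (i, k) * B $$ (k, j) = (if k = i then if i = j then 1 else 0 else 0)"
        using A B ij by (cases "l i < l k") (auto simp: level_matrices_def)
    qed
    then show ?thesis using ij by simp
  qed
  then show ?thesis
    using A B by (auto simp: level_matrices_def)
qed

text \<open>Weights telescope along \<open>i\<close>, \<open>k\<close>, \<open>j\<close> when the
  levels do not drop, and a summand with a drop vanishes. Truncated subtraction gives the constant
  entries weight 0.\<close>

lemma weighted_polys_level_mult:
  assumes A: "\<And>x. A x \<in> level_matrices N l" and B: "\<And>x. B x \<in> level_matrices N l"
    and polyA: "\<And>i j. i < N \<Longrightarrow> j < N \<Longrightarrow> (\<lambda>x. A x $$ (i, j)) \<in> weighted_polys V w (l j - l i)"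
    and polyB: "\<And>i j. i < N \<Longrightarrow> j < N \<Longrightarrow> (\<lambda>x. B x $$ (i, j)) \<in> weighted_polys V w (l j - l i)"
    and ij: "i < N" "j < N"
  shows "(\<lambda>x. (A x * B x) $$ (i, j)) \<in> weighted_polys V w (l j - l i)"
proof -
  have "(\<lambda>x. A x $$ (i, k) * B x $$ (k, j)) \<in> weighted_polys V w (l j - l i)" if "k < N" for k
  proof (cases "l i \<le> l k \<and> l k \<le> l j")
    case True
    then have "l j - l i = (l k - l i) + (l j - l k)"
      by simp
    then show ?thesis
      using weighted_polys_mult[OF polyA polyB, of i k k j] ij that by simp
  next
    case False
    moreover have "X $$ (a, b) = 0" if "X \<in> level_matrices N l" "a < N" "b < N" "l b < l a" for X :: "'b mat" and a b
      using that by (auto simp: level_matrices_def)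
    ultimately have "A x $$ (i, k) * B x $$ (k, j) = 0" for x
      using A[of x] B[of x] ij that by (auto simp: not_le)
    then show ?thesis
      by (simp only: weighted_polys_const)
  qed
  then show ?thesis
    unfolding level_matrices_mult_index[OF A B ij] by (intro weighted_polys_sum) auto
qed

lemma weighted_polys_matrix_of_entries:
  assumes "\<And>s. s \<in> free_entries N l \<Longrightarrow> (\<lambda>x. f x s) \<in> weighted_polys V w (entry_weight l s)"
    and "i < N" "j < N"
  shows "(\<lambda>x. matrix_of_entries N l (f x) $$ (i, j)) \<in> weighted_polys V w (l j - l i)"
  using assms by (cases "l i < l j")
    (auto simp: matrix_of_entries_def free_entries_def entry_weight_def weighted_polys_const)

subsection \<open>The annihilator of the monomials of low degree\<close>

text \<open>The bound is a third of the largest weighted degree of a reduced monomial, written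
  without division. \<open>PiE\<close> fixes the values off the free entries, so the set is
  finite.\<close>

definition low_degree_exponents :: "nat \<Rightarrow> nat \<Rightarrow> (nat \<Rightarrow> nat) \<Rightarrow> (nat \<times> nat \<Rightarrow> nat) set" where
  "low_degree_exponents q N l = {e \<in> PiE (free_entries N l) (\<lambda>_. {..<q}).
     3 * (\<Sum>s\<in>free_entries N l. entry_weight l s * e s)
       \<le> (q - 1) * (\<Sum>s\<in>free_entries N l. entry_weight l s)}"

definition low_degree_annihilator ::
  "('a::{field,finite} mat, 'm) monoid_scheme \<Rightarrow> nat \<Rightarrow> (nat \<Rightarrow> nat) \<Rightarrow> ('a mat \<Rightarrow> 'a) set" where
  "low_degree_annihilator G N l = {u \<in> group_algebra G.
     \<forall>e\<in>low_degree_exponents CARD('a) N l.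
       (\<Sum>A\<in>carrier G. u A * monomial_fun (free_entries N l) e (\<lambda>s. A $$ s)) = 0}"

text \<open>Reducing each exponent below \<open>CARD('a)\<close> keeps the monomial function and
  does not raise its weighted degree, so orthogonality extends to exponents of any size.\<close>

lemma low_degree_annihilatorD:
  fixes u :: "'a::{field,finite} mat \<Rightarrow> 'a"
  assumes "u \<in> low_degree_annihilator G N l"
    and le: "3 * (\<Sum>s\<in>free_entries N l. entry_weight l s * e s)
       \<le> (CARD('a) - 1) * (\<Sum>s\<in>free_entries N l. entry_weight l s)"
  shows "(\<Sum>A\<in>carrier G. u A * monomial_fun (free_entries N l) e (\<lambda>s. A $$ s)) = 0"
proof -
  let ?S = "free_entries N l"
  have "\<exists>e'. e' < CARD('a) \<and> e' \<le> e s \<and> (\<forall>x::'a. x ^ e' = x ^ e s)" for s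
    by (metis finite_field_power_reduce)
  then obtain r where r: "\<And>s. r s < CARD('a)" "\<And>s. r s \<le> e s" "\<And>s (x::'a). x ^ r s = x ^ e s"
    by metis
  define e' where "e' = restrict r ?S"
  have "(\<Sum>s\<in>?S. entry_weight l s * e' s) \<le> (\<Sum>s\<in>?S. entry_weight l s * e s)"
    using r(2) by (intro sum_mono) (simp add: e'_def)
  then have "e' \<in> low_degree_exponents CARD('a) N l"
    using le r(1) by (auto simp: low_degree_exponents_def e'_def)
  moreover have "monomial_fun ?S e' x = monomial_fun ?S e x" for x :: "nat \<times> nat \<Rightarrow> 'a"
    unfolding monomial_fun_def using r(3) by (intro prod.cong) (simp_all add: e'_def)
  moreover have "(\<Sum>A\<in>carrier G. u A * monomial_fun ?S e' (\<lambda>s. A $$ s)) = 0"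
    if "e' \<in> low_degree_exponents CARD('a) N l"
    using assms(1) that unfolding low_degree_annihilator_def by blast
  ultimately show ?thesis
    by simp
qed

text \<open>The variable \<open>(t, s)\<close> is entry \<open>s\<close> of the matrix number
  \<open>t\<close>. For a monomial the triple sum splits into a product of three sums, and the three
  weighted degrees add up to at most the bound, so one of them is at most a third of it and its sum
  vanishes. Linearity does the rest.\<close>

lemma trilinear_low_degree_eq_0:
  fixes u :: "nat \<Rightarrow> 'a::{field,finite} mat \<Rightarrow> 'a"
  assumes u: "\<And>t. t < 3 \<Longrightarrow> u t \<in> low_degree_annihilator G N l"
    and f: "f \<in> weighted_polys ({..<3::nat} \<times> free_entries N l) (\<lambda>(t, s). entry_weight l s)
      ((CARD('a) - 1) * (\<Sum>s\<in>free_entries N l. entry_weight l s))"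
  shows "(\<Sum>A\<in>carrier G. \<Sum>B\<in>carrier G. \<Sum>C\<in>carrier G. u 0 A * u 1 B * u 2 C *
    f (\<lambda>(t, s). (if t = 0 then A else if t = 1 then B else C) $$ s)) = 0" (is "?T f = 0")
proof -
  let ?S = "free_entries N l" and ?W = "\<lambda>e. \<Sum>s\<in>free_entries N l. entry_weight l s * e s"
  let ?D = "(CARD('a) - 1) * (\<Sum>s\<in>?S. entry_weight l s)"
  let ?m = "\<lambda>e t A. monomial_fun ?S (\<lambda>s. e (t, s)) (\<lambda>s. A $$ s)"
  have three: "{..<3} = {0, 1, 2::nat}"
    by auto
  have mono: "?T (monomial_fun ({..<3::nat} \<times> ?S) e) = 0"
    if e: "(\<Sum>v\<in>{..<3::nat} \<times> ?S. (case v of (t, s) \<Rightarrow> entry_weight l s) * e v) \<le> ?D"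
    for e :: "nat \<times> nat \<times> nat \<Rightarrow> nat"
  proof -
    have "(\<Sum>t<3::nat. ?W (\<lambda>s. e (t, s))) \<le> ?D"
      using e by (simp add: sum.cartesian_product case_prod_unfold)
    then have "?W (\<lambda>s. e (0, s)) + ?W (\<lambda>s. e (1, s)) + ?W (\<lambda>s. e (2, s)) \<le> ?D"
      by (simp add: three)
    then have "3 * ?W (\<lambda>s. e (0, s)) \<le> ?D \<or> 3 * ?W (\<lambda>s. e (1, s)) \<le> ?D \<or> 3 * ?W (\<lambda>s. e (2, s)) \<le> ?D"
      by linarith
    then have zero: "(\<Sum>A\<in>carrier G. u 0 A * ?m e 0 A) = 0 \<or> (\<Sum>A\<in>carrier G. u 1 A * ?m e 1 A) = 0 \<or>
        (\<Sum>A\<in>carrier G. u 2 A * ?m e 2 A) = 0"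
      using low_degree_annihilatorD[OF u[of 0]] low_degree_annihilatorD[OF u[of 1]]
        low_degree_annihilatorD[OF u[of 2]] by force
    have "monomial_fun ({..<3::nat} \<times> ?S) e (\<lambda>(t, s). (if t = 0 then A else if t = 1 then B else C) $$ s)
        = ?m e 0 A * ?m e 1 B * ?m e 2 C" for A B C :: "'a mat"
    proof -
      have "monomial_fun ({..<3::nat} \<times> ?S) e (\<lambda>(t, s). (if t = 0 then A else if t = 1 then B else C) $$ s)
        = (\<Prod>t<3::nat. \<Prod>s\<in>?S. (if t = 0 then A else if t = 1 then B else C) $$ s ^ e (t, s))"
        by (simp add: monomial_fun_def prod.cartesian_product case_prod_unfold)
      then show ?thesis
        by (simp add: three monomial_fun_def mult.assoc)
    qed
    then have "?T (monomial_fun ({..<3::nat} \<times> ?S) e) = (\<Sum>A\<in>carrier G. \<Sum>B\<in>carrier G. \<Sum>C\<in>carrier G.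
        (u 0 A * ?m e 0 A) * ((u 1 B * ?m e 1 B) * (u 2 C * ?m e 2 C)))"
      by (intro sum.cong refl) (simp only: mult_ac)
    also have "\<dots> = (\<Sum>A\<in>carrier G. u 0 A * ?m e 0 A) *
        ((\<Sum>B\<in>carrier G. u 1 B * ?m e 1 B) * (\<Sum>C\<in>carrier G. u 2 C * ?m e 2 C))"
      by (simp only: sum_distrib_left[symmetric] sum_distrib_right[symmetric])
    also have "\<dots> = 0"
      using zero by auto
    finally show ?thesis .
  qed
  have sub: "fun_space.subspace {f. ?T f = 0}"
  proof (unfold fun_space.subspace_def, intro conjI ballI allI)
    show "0 \<in> {f. ?T f = 0}"
      by simp
    show "f + g \<in> {f. ?T f = 0}" if "f \<in> {f. ?T f = 0}" "g \<in> {f. ?T f = 0}" for f g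
      using that by (simp add: distrib_left sum.distrib)
    show "fun_scale c f \<in> {f. ?T f = 0}" if "f \<in> {f. ?T f = 0}" for c f
    proof -
      have "?T (fun_scale c f) = c * ?T f"
        by (simp add: fun_scale_def sum_distrib_left mult_ac)
      then show ?thesis using that by simp
    qed
  qed
  have "weighted_polys ({..<3::nat} \<times> ?S) (\<lambda>(t, s). entry_weight l s) ?D \<subseteq> {f. ?T f = 0}"
    unfolding weighted_polys_def by (intro fun_space.span_minimal sub) (use mono in auto)
  then show ?thesis using f by blast
qed

section \<open>Triple products in the group algebra\<close>

lemma ga_mult_eq_sum:
  assumes "finite (carrier G)"
  shows "ga_mult G u v g = (\<Sum>h\<in>carrier G. \<Sum>k\<in>carrier G. if h \<otimes>\<^bsub>G\<^esub> k = g then u h * v k else 0)"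
proof -
  have "ga_mult G u v g = (\<Sum>(h, k)\<in>{z \<in> carrier G \<times> carrier G. fst z \<otimes>\<^bsub>G\<^esub> snd z = g}. u h * v k)"
    unfolding ga_mult_def by (intro sum.cong) auto
  also have "\<dots> = (\<Sum>z\<in>carrier G \<times> carrier G.
      if fst z \<otimes>\<^bsub>G\<^esub> snd z = g then case z of (h, k) \<Rightarrow> u h * v k else 0)"
    using assms by (subst sum.inter_filter) auto
  also have "\<dots> = (\<Sum>h\<in>carrier G. \<Sum>k\<in>carrier G. if h \<otimes>\<^bsub>G\<^esub> k = g then u h * v k else 0)"
    by (subst sum.cartesian_product) (auto intro!: sum.cong)
  finally show ?thesis .
qed

lemma ga_mult3_eq_sum:
  assumes fin: "finite (carrier G)"
    and closed: "\<And>a b. a \<in> carrier G \<Longrightarrow> b \<in> carrier G \<Longrightarrow> a \<otimes>\<^bsub>G\<^esub> b \<in> carrier G"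
  shows "ga_mult G (ga_mult G u v) w g = (\<Sum>a\<in>carrier G. \<Sum>b\<in>carrier G. \<Sum>c\<in>carrier G.
    u a * v b * w c * (if (a \<otimes>\<^bsub>G\<^esub> b) \<otimes>\<^bsub>G\<^esub> c = g then 1 else 0))"
proof -
  let ?C = "carrier G"
  have "ga_mult G (ga_mult G u v) w g = (\<Sum>h\<in>?C. \<Sum>c\<in>?C. \<Sum>a\<in>?C. \<Sum>b\<in>?C.
      if a \<otimes>\<^bsub>G\<^esub> b = h then (if h \<otimes>\<^bsub>G\<^esub> c = g then u a * v b * w c else 0) else 0)"
    unfolding ga_mult_eq_sum[OF fin]
    by (intro sum.cong refl) (auto simp: sum_distrib_right if_distrib cong: if_cong intro!: sum.cong)
  \<comment> \<open>With \<open>h\<close> innermost, its sum collapses to the product of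
    \<open>a\<close> and \<open>b\<close>, which lies in the range by closure.\<close>
  also have "\<dots> = (\<Sum>c\<in>?C. \<Sum>a\<in>?C. \<Sum>b\<in>?C. \<Sum>h\<in>?C.
      if a \<otimes>\<^bsub>G\<^esub> b = h then (if h \<otimes>\<^bsub>G\<^esub> c = g then u a * v b * w c else 0) else 0)"
    by (rule trans[OF sum.swap], rule sum.cong[OF refl], rule trans[OF sum.swap],
        rule sum.cong[OF refl], rule sum.swap)
  also have "\<dots> = (\<Sum>c\<in>?C. \<Sum>a\<in>?C. \<Sum>b\<in>?C.
      if (a \<otimes>\<^bsub>G\<^esub> b) \<otimes>\<^bsub>G\<^esub> c = g then u a * v b * w c else 0)"
    using fin closed by (intro sum.cong refl) simp
  also have "\<dots> = (\<Sum>a\<in>?C. \<Sum>b\<in>?C. \<Sum>c\<in>?C.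
      if (a \<otimes>\<^bsub>G\<^esub> b) \<otimes>\<^bsub>G\<^esub> c = g then u a * v b * w c else 0)"
    by (rule trans[OF sum.swap], rule sum.cong[OF refl], rule sum.swap)
  finally show ?thesis
    by (simp add: if_distrib cong: if_cong)
qed

lemma cube_zero_low_degree_annihilator:
  fixes G :: "'a::{field,finite} mat monoid"
  assumes G: "carrier G = level_matrices N l" "monoid.mult G = (*)"
  shows "cube_zero G (low_degree_annihilator G N l)"
  unfolding cube_zero_def
proof (intro ballI ext)
  fix u v w :: "'a mat \<Rightarrow> 'a" and g :: "'a mat"
  assume u: "u \<in> low_degree_annihilator G N l" and v: "v \<in> low_degree_annihilator G N l"
    and w: "w \<in> low_degree_annihilator G N l"
  let ?S = "free_entries N l" and ?C = "level_matrices N l :: 'a mat set"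
  let ?V = "{..<3::nat} \<times> ?S" and ?w = "\<lambda>(t::nat, s). entry_weight l s"
  let ?q = "CARD('a) - 1"
  let ?M = "\<lambda>t x. matrix_of_entries N l (\<lambda>s. x (t, s)) :: 'a mat"
  let ?P = "\<lambda>x. ?M (0::nat) x * ?M 1 x * ?M 2 x"
  have mult_eq: "ga_mult G (ga_mult G u v) w g
      = (\<Sum>A\<in>?C. \<Sum>B\<in>?C. \<Sum>C\<in>?C. u A * v B * w C * (if A * B * C = g then 1 else 0))"
    using ga_mult3_eq_sum[of G u v w g] by (simp add: G level_matrices_finite_card level_matrices_mult_closed)
  show "ga_mult G (ga_mult G u v) w g = 0 g"
  proof (cases "g \<in> ?C")
    case False
    then have "A * B * C \<noteq> g" if "A \<in> ?C" "B \<in> ?C" "C \<in> ?C" for A B C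
      using that level_matrices_mult_closed by metis
    then show ?thesis
      by (simp add: mult_eq)
  next
    case g: True
    \<comment> \<open>on the group, \<open>f\<close> is the indicator function of \<open>A * B * C = g\<close>\<close>
    define f where "f x = (\<Prod>s\<in>?S. 1 - (?P x $$ s - g $$ s) ^ ?q)" for x
    have M: "(\<lambda>x. ?M t x $$ (i, j)) \<in> weighted_polys ?V ?w (l j - l i)"
      if "t < 3" "i < N" "j < N" for t i j
    proof (rule weighted_polys_matrix_of_entries[OF _ that(2,3)])
      fix s assume "s \<in> ?S"
      then show "(\<lambda>x. x (t, s)) \<in> weighted_polys ?V ?w (entry_weight l s)"
        using weighted_polys_var[of ?V "(t, s)" ?w] finite_free_entries that by simp
    qed
    have "(\<lambda>x. (?M 0 x * ?M 1 x) $$ (i, j)) \<in> weighted_polys ?V ?w (l j - l i)" if "i < N" "j < N" for i j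
      by (rule weighted_polys_level_mult[OF matrix_of_entries_in matrix_of_entries_in M M that]) simp_all
    then have "(\<lambda>x. ?P x $$ (i, j)) \<in> weighted_polys ?V ?w (l j - l i)" if "i < N" "j < N" for i j
      by (rule weighted_polys_level_mult[OF level_matrices_mult_closed[OF matrix_of_entries_in matrix_of_entries_in]
            matrix_of_entries_in _ M that]) simp_all
    then have P: "(\<lambda>x. ?P x $$ s) \<in> weighted_polys ?V ?w (entry_weight l s)" if "s \<in> ?S" for s
      using that by (auto simp: free_entries_def entry_weight_def)
    \<comment> \<open>The factor for \<open>s\<close> is a polynomial of weight
      \<open>?q * entry_weight l s\<close>; these weights add up to exactly the bound of the
      trilinear lemma.\<close>
    have "f \<in> weighted_polys ?V ?w (\<Sum>s\<in>?S. ?q * entry_weight l s)"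
      unfolding f_def
      by (intro weighted_polys_prod weighted_polys_diff weighted_polys_power weighted_polys_const P)
    then have f: "f \<in> weighted_polys ?V ?w (?q * (\<Sum>s\<in>?S. entry_weight l s))"
      by (simp add: sum_distrib_left)
    have f_eq: "f (\<lambda>(t, s). (if t = 0 then A else if t = 1 then B else C) $$ s)
        = (if A * B * C = g then 1 else 0)" if ABC: "A \<in> ?C" "B \<in> ?C" "C \<in> ?C" for A B C
    proof -
      let ?x = "\<lambda>(t::nat, s). (if t = 0 then A else if t = 1 then B else C) $$ s"
      have "?M 0 ?x = A" "?M 1 ?x = B" "?M 2 ?x = C"
        using ABC by (auto intro!: matrix_of_entries_index)
      then have fx: "f ?x = (\<Prod>s\<in>?S. 1 - ((A * B * C) $$ s - g $$ s) ^ ?q)"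
        by (simp add: f_def)
      have in_C: "A * B * C \<in> ?C"
        using ABC by (intro level_matrices_mult_closed)
      \<comment> \<open>This makes \<open>0 ^ ?q\<close> equal to 0, so that factors with agreeing
        entries are 1.\<close>
      have q: "?q > 0"
        using card_mono[of "UNIV :: 'a set" "{0, 1}"] by simp
      show ?thesis
      proof (cases "A * B * C = g")
        case True
        then show ?thesis using q by (simp add: fx power_0_left)
      next
        case False
        \<comment> \<open>Matrices of the group are determined by their free entries, so two
          different ones differ at some \<open>s\<close>; the factor for that \<open>s\<close> is 0
          by Fermat's theorem.\<close>
        then obtain s where "s \<in> ?S" "(A * B * C) $$ s \<noteq> g $$ s"
          using matrix_of_entries_index[OF in_C, of "\<lambda>s. g $$ s"] matrix_of_entries_index[OF g, of "\<lambda>s. g $$ s"]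
          by metis
        then have "\<exists>s\<in>?S. 1 - ((A * B * C) $$ s - g $$ s) ^ ?q = 0"
          using finite_field_power_card[of "(A * B * C) $$ s - g $$ s"] by (intro bexI[of _ s]) auto
        then show ?thesis
          using False finite_free_entries by (simp add: fx)
      qed
    qed
    have "ga_mult G (ga_mult G u v) w g = (\<Sum>A\<in>?C. \<Sum>B\<in>?C. \<Sum>C\<in>?C. u A * v B * w C *
        f (\<lambda>(t, s). (if t = 0 then A else if t = 1 then B else C) $$ s))"
      unfolding mult_eq by (intro sum.cong refl) (simp add: f_eq)
    also have "\<dots> = 0"
      using trilinear_low_degree_eq_0[of "\<lambda>t. if t = 0 then u else if t = 1 then v else w" G N l f] u v w f
      by (simp add: G)
    finally show ?thesis by simp
  qed
qed

lemma level_group_low_codim_subspace: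
  fixes G :: "'a::{field,finite} mat monoid" and t \<delta> :: real
  assumes G: "carrier G = level_matrices N l" "monoid.mult G = (*)"
    and W: "W > 0" "\<And>s. s \<in> free_entries N l \<Longrightarrow> entry_weight l s \<le> W"
      "card (free_entries N l) * W \<le> 3 * (\<Sum>s\<in>free_entries N l. entry_weight l s)"
    and t: "t > 0" "\<delta> > 0"
      "(\<Sum>e<CARD('a). exp (t * (real (CARD('a) - 1) - 3 * real e))) = real CARD('a) * (1 - \<delta>)"
  shows "\<exists>X :: ('a mat \<Rightarrow> 'a) set. X \<subseteq> group_algebra G \<and> fun_space.subspace X \<and> cube_zero G X \<and>
    ga_codim G X \<le> real (Coset.order G) * exp (- (\<delta> / 3 * card (free_entries N l)))"
proof -
  let ?S = "free_entries N l"
  let ?X = "low_degree_annihilator G N l" and ?E = "low_degree_exponents CARD('a) N l"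
  let ?\<phi> = "\<lambda>e u. \<Sum>A\<in>carrier G. u A * monomial_fun ?S e (\<lambda>s. A $$ s)"
  have fin: "finite (carrier G)"
    by (simp add: G level_matrices_finite_card)
  note basis = group_algebra_basis[OF fin, where ?'a = 'a]
  have finE: "finite ?E"
    unfolding low_degree_exponents_def 
    by (rule finite_subset[of _ "PiE ?S (\<lambda>_. {..<CARD('a)})"])
      (auto intro!: finite_PiE finite_free_entries)
  \<comment> \<open>Each exponent vector imposes one linear condition, so the codimension is at most
    \<open>card ?E\<close>.\<close>
  have *: "fun_space.subspace {u \<in> group_algebra G. \<forall>e\<in>?E. ?\<phi> e u = 0} \<and>
      fun_space.dim (group_algebra G :: ('a mat \<Rightarrow> 'a) set)
        \<le> fun_space.dim {u \<in> group_algebra G. \<forall>e\<in>?E. ?\<phi> e u = 0} + card ?E"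
    by (rule dim_le_dim_common_kernel[OF finE basis(1) equalityD1[OF basis(3)] basis(2)])
      (simp_all add: distrib_right sum.distrib fun_scale_def sum_distrib_left mult.assoc)
  have "real (card ?E) \<le> real CARD('a) ^ card ?S * exp (- (\<delta> / 3 * card ?S))"
    unfolding low_degree_exponents_def
    by (rule card_low_degree_exponents_le[OF finite_free_entries W t(3,1,2)])
  moreover have "Coset.order G = CARD('a) ^ card ?S"
    by (simp add: Coset.order_def G level_matrices_finite_card)
  moreover have "ga_codim G ?X \<le> real (card ?E)"
    using * by (simp add: ga_codim_def low_degree_annihilator_def basis(4) Coset.order_def)
  ultimately have "ga_codim G ?X \<le> real (Coset.order G) * exp (- (\<delta> / 3 * card ?S))"
    by simp
  moreover have "?X \<subseteq> group_algebra G" "fun_space.subspace ?X"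
    using * by (auto simp: low_degree_annihilator_def)
  ultimately show ?thesis
    using cube_zero_low_degree_annihilator[OF G] by blast
qed

subsection \<open>The two families\<close>

lemma free_entries_Suc:
  "free_entries (Suc n) (\<lambda>i. i) = free_entries n (\<lambda>i. i) \<union> (\<lambda>i. (i, n)) ` {..<n}"
  by (auto simp: free_entries_def less_Suc_eq)

text \<open>Passing to the next size adds a last column, whose weights run from its length down to
  1. The factors 2 and 6 clear the denominators of the binomial coefficients.\<close>

lemma card_sum_free_entries:
  "2 * card (free_entries (Suc m) (\<lambda>i. i)) = m * (m + 1) \<and>
   6 * (\<Sum>s\<in>free_entries (Suc m) (\<lambda>i. i). entry_weight (\<lambda>i. i) s) = m * (m + 1) * (m + 2)"
proof (induction m)
  case 0
  have "free_entries (Suc 0) (\<lambda>i. i) = {}"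
    by (auto simp: free_entries_def)
  then show ?case by simp
next
  case (Suc m)
  let ?n = "Suc m"
  have disj: "free_entries ?n (\<lambda>i. i) \<inter> (\<lambda>i. (i, ?n)) ` {..<?n} = {}"
    by (auto simp: free_entries_def)
  have inj: "inj_on (\<lambda>i. (i, ?n)) {..<?n}"
    by (rule inj_onI) simp
  have gauss: "2 * (\<Sum>i<k. k - i) = k * (k + 1)" for k :: nat
    by (induction k) (simp_all add: sum.lessThan_Suc_shift del: sum.lessThan_Suc)
  have "card (free_entries (Suc ?n) (\<lambda>i. i)) = card (free_entries ?n (\<lambda>i. i)) + ?n"
    by (subst free_entries_Suc, subst card_Un_disjoint)
      (simp_all add: finite_free_entries disj card_image[OF inj])
  moreover have "(\<Sum>s\<in>free_entries (Suc ?n) (\<lambda>i. i). entry_weight (\<lambda>i. i) s)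
      = (\<Sum>s\<in>free_entries ?n (\<lambda>i. i). entry_weight (\<lambda>i. i) s) + (\<Sum>i<?n. ?n - i)"
    by (subst free_entries_Suc, subst sum.union_disjoint)
      (simp_all add: finite_free_entries disj sum.reindex[OF inj] entry_weight_def del: sum.lessThan_Suc)
  ultimately show ?case
    using Suc gauss[of ?n] by (simp add: algebra_simps del: sum.lessThan_Suc)
qed

lemma unitriangular_group_level:
  assumes "n \<ge> 2"
  shows "carrier (unitriangular_group n) = level_matrices n (\<lambda>i. i)"
    "free_entries n (\<lambda>i. i) \<noteq> {}"
    "\<And>s. s \<in> free_entries n (\<lambda>i. i) \<Longrightarrow> entry_weight (\<lambda>i. i) s \<le> n - 1"
    "card (free_entries n (\<lambda>i. i)) * (n - 1) \<le> 3 * (\<Sum>s\<in>free_entries n (\<lambda>i. i). entry_weight (\<lambda>i. i) s)"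
proof -
  show "carrier (unitriangular_group n) = level_matrices n (\<lambda>i. i)"
    by (auto simp: unitriangular_group_def level_matrices_def upper_triangular_def nat_neq_iff)
  have "(0, 1) \<in> free_entries n (\<lambda>i. i)"
    using assms by (auto simp: free_entries_def)
  then show "free_entries n (\<lambda>i. i) \<noteq> {}" by blast
  show "entry_weight (\<lambda>i. i) s \<le> n - 1" if "s \<in> free_entries n (\<lambda>i. i)" for s
    using that by (auto simp: free_entries_def entry_weight_def)
  define m where "m = n - 1"
  have n: "n = Suc m"
    using assms by (simp add: m_def)
  let ?c = "card (free_entries n (\<lambda>i. i))"
  have "2 * (?c * m) = (m * (m + 1)) * m"
    using card_sum_free_entries[of m] unfolding n by (metis mult.assoc)
  \<comment> \<open>The average weight is \<open>(m + 2) / 3\<close> and the maximal one is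
    \<open>m\<close>; for large \<open>m\<close> their ratio is close to a third.\<close>
  also have "\<dots> \<le> (m * (m + 1)) * (m + 2)"
    by (intro mult_left_mono) auto
  also have "\<dots> = 6 * (\<Sum>s\<in>free_entries n (\<lambda>i. i). entry_weight (\<lambda>i. i) s)"
    using card_sum_free_entries[of m] unfolding n by simp
  finally show "?c * (n - 1) \<le> 3 * (\<Sum>s\<in>free_entries n (\<lambda>i. i). entry_weight (\<lambda>i. i) s)"
    by (simp add: m_def mult.commute)
qed

text \<open>All weights are 1 or 2, so the average is at least half of the bound 2. For
  \<open>m = 0\<close> there is no middle level, and the only free entry has weight 2.\<close>

lemma heisenberg_group_level:
  fixes m :: nat
  defines "l \<equiv> \<lambda>i. if i = 0 then 0 else if i \<le> m then 1 else 2 :: nat"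
  shows "carrier (heisenberg_group m :: 'a::field mat monoid) = level_matrices (m + 2) l"
    "free_entries (m + 2) l \<noteq> {}"
    "\<And>s. s \<in> free_entries (m + 2) l \<Longrightarrow> entry_weight l s \<le> 2"
    "card (free_entries (m + 2) l) * 2 \<le> 3 * (\<Sum>s\<in>free_entries (m + 2) l. entry_weight l s)"
proof -
  have less_iff: "l i < l j \<longleftrightarrow> (i = 0 \<and> j > 0) \<or> (j = m + 1 \<and> i < m + 1)"
    if "i \<le> m + 1" "j \<le> m + 1" for i j
    using that by (auto simp: l_def)
  show "carrier (heisenberg_group m :: 'a::field mat monoid) = level_matrices (m + 2) l"
  proof (rule Set.set_eqI)
    fix A :: "'a mat"
    have "A \<in> level_matrices (m + 2) l \<longleftrightarrow> A \<in> carrier_mat (m + 2) (m + 2) \<and>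
      (\<forall>i\<le>m + 1. \<forall>j\<le>m + 1. \<not> ((i = 0 \<and> j > 0) \<or> (j = m + 1 \<and> i < m + 1)) \<longrightarrow>
        A $$ (i, j) = (if i = j then 1 else 0))"
      using less_iff by (auto simp: level_matrices_def less_Suc_eq_le)
    also have "\<dots> \<longleftrightarrow> A \<in> carrier (heisenberg_group m :: 'a mat monoid)"
    proof -
      have "m + 1 + 1 = m + 2"
        by simp
      then show ?thesis
        unfolding heisenberg_group_def Let_def partial_object.simps mem_Collect_eq
        by (simp only:, intro conj_cong refl) (smt (verit) less_irrefl)
    qed
    finally show "A \<in> carrier (heisenberg_group m :: 'a mat monoid) \<longleftrightarrow> A \<in> level_matrices (m + 2) l" ..
  qed
  have "(0, m + 1) \<in> free_entries (m + 2) l"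
    by (auto simp: free_entries_def l_def)
  then show "free_entries (m + 2) l \<noteq> {}" by blast
  show "entry_weight l s \<le> 2" for s
    by (auto simp: entry_weight_def l_def split: prod.splits)
  have "card (free_entries (m + 2) l) \<le> (\<Sum>s\<in>free_entries (m + 2) l. entry_weight l s)"
  proof -
    have "(\<Sum>s\<in>free_entries (m + 2) l. 1) \<le> (\<Sum>s\<in>free_entries (m + 2) l. entry_weight l s)"
      by (intro sum_mono) (auto simp: free_entries_def entry_weight_def)
    then show ?thesis by simp
  qed
  then show "card (free_entries (m + 2) l) * 2 \<le> 3 * (\<Sum>s\<in>free_entries (m + 2) l. entry_weight l s)"
    by simp
qed

theorem theorem6:
  "\<exists>lam::real. lam > 0 \<and>
     (\<forall>G :: 'p::prime_card mod_ring mat monoid.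
        (\<exists>n\<ge>1. G = heisenberg_group (n - 1)) \<or> (\<exists>n\<ge>2. G = unitriangular_group n) \<longrightarrow>
        (\<exists>X :: ('p mod_ring mat \<Rightarrow> 'p mod_ring) set.
           X \<subseteq> group_algebra G \<and> fun_space.subspace X \<and> cube_zero G X \<and>
           ga_codim G X < real (Coset.order G) powr (1 - lam)))"
proof -
  define p where "p = CARD('p mod_ring)"
  have p: "p \<ge> 2"
    using prime_card[where ?'a = 'p] prime_ge_2_nat by (simp add: p_def)
  obtain t :: real where t: "t > 0" "(\<Sum>e<p. exp (t * (real (p - 1) - 3 * real e))) < real p"
    using exists_exp_sum_less[OF p] by blast
  \<comment> \<open>The relative gap left by the choice of \<open>t\<close>; it depends only on
    \<open>p\<close>.\<close>
  define \<delta> where "\<delta> = 1 - (\<Sum>e<p. exp (t * (real (p - 1) - 3 * real e))) / real p"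
  have \<delta>: "\<delta> > 0" "(\<Sum>e<p. exp (t * (real (p - 1) - 3 * real e))) = real p * (1 - \<delta>)"
    using t p by (simp_all add: \<delta>_def field_simps)
  \<comment> \<open>Dividing by \<open>ln p\<close> turns exponential savings in the number of free
    entries into a power of the order \<open>p ^ k\<close>. The 6 halves the rate
    \<open>\<delta> / 3\<close>, which leaves room for a strict inequality.\<close>
  define lam where "lam = \<delta> / (6 * ln (real p))"
  have lnp: "ln (real p) > 0"
    using p by simp
  have bound: "\<exists>X :: ('p mod_ring mat \<Rightarrow> 'p mod_ring) set.
      X \<subseteq> group_algebra G \<and> fun_space.subspace X \<and> cube_zero G X \<and>
      ga_codim G X < real (Coset.order G) powr (1 - lam)"
    if G: "carrier G = level_matrices N l" "monoid.mult G = (*)" and ne: "free_entries N l \<noteq> {}"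
      and W: "W > 0" "\<And>s. s \<in> free_entries N l \<Longrightarrow> entry_weight l s \<le> W"
        "card (free_entries N l) * W \<le> 3 * (\<Sum>s\<in>free_entries N l. entry_weight l s)"
    for G :: "'p mod_ring mat monoid" and N l W
  proof -
    define k where "k = card (free_entries N l)"
    \<comment> \<open>Strictness needs a free entry: the bound fails for the trivial group.\<close>
    have k: "k > 0"
      using ne finite_free_entries by (simp add: k_def card_gt_0_iff)
    have ord: "real (Coset.order G) = real p ^ k"
      by (simp add: Coset.order_def G level_matrices_finite_card p_def k_def)
    have "real (Coset.order G) * exp (- (\<delta> / 3 * real k)) < real (Coset.order G) * exp (- (\<delta> / 6 * real k))"
      using \<delta>(1) k p by (simp add: ord)
    also have "\<dots> = real (Coset.order G) powr (1 - lam)"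
    proof -
      have "real (Coset.order G) = exp (real k * ln (real p))"
        using p by (simp add: ord exp_of_nat_mult)
      then show ?thesis
        using lnp by (simp add: powr_def lam_def algebra_simps flip: exp_add)
    qed
    finally have "real (Coset.order G) * exp (- (\<delta> / 3 * real k)) < real (Coset.order G) powr (1 - lam)" .
    then show ?thesis
      using level_group_low_codim_subspace[OF G W t(1) \<delta>(1) \<delta>(2)[unfolded p_def]]
      unfolding k_def by (meson le_less_trans)
  qed
  have "\<exists>X :: ('p mod_ring mat \<Rightarrow> 'p mod_ring) set.
      X \<subseteq> group_algebra G \<and> fun_space.subspace X \<and> cube_zero G X \<and>
      ga_codim G X < real (Coset.order G) powr (1 - lam)"
    if "(\<exists>n\<ge>1. G = heisenberg_group (n - 1)) \<or> (\<exists>n\<ge>2. G = unitriangular_group n)"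
    for G :: "'p mod_ring mat monoid"
    using that
  proof (elim disjE exE conjE)
    fix n assume G: "G = heisenberg_group (n - 1)"
    have "monoid.mult G = (*)"
      by (simp add: G heisenberg_group_def Let_def)
    then show ?thesis
      using heisenberg_group_level unfolding G by (intro bound[where W = 2]) auto
  next
    fix n :: nat assume n: "n \<ge> 2" and G: "G = unitriangular_group n"
    have "monoid.mult G = (*)"
      by (simp add: G unitriangular_group_def)
    then show ?thesis
      using unitriangular_group_level[OF n] n unfolding G by (intro bound[where W = "n - 1"]) auto
  qed
  moreover have "lam > 0"
    using \<delta>(1) lnp by (simp add: lam_def)
  ultimately show ?thesis by blast
qed

end
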